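(* Let $\varOmega\subset\mathbb{R}^d$ be an open set with finite Lebesgue measure $M>0$, let $K\subset\mathbb{R}^l$ be compact, and let $u\colon\varOmega\to K$ be a measurable function. Then the quasi-Young measures associated with $u$ are precisely the homogeneous Young measures associated with $u$. That is, a family $(\nu_x)_{x\in\varOmega}$ of elements of $\mathrm{rca}(K)$ is a quasi-Young measure associated with $u$ if and only if it is a homogeneous Young measure associated with $u$.
   Context: $\mu$ denotes the normalized Lebesgue measure on $\varOmega$, $d\mu(x)=\frac1M\,dx$. $\mathrm{rca}(K)$ is the Banach space of regular, countably additive scalar (real-valued) Borel measures on $K$ with the total variation norm, and $\mathrm{rca}^1(K)$ is its subset of probability measures. A family $(\nu_x)_{x\in\varOmega}$ of elements of $\mathrm{rca}(K)$ is a quasi-Young measure associated with $u$ if for every $x\in\varOmega$ and every integrable function $\beta\colon K\to\mathbb{R}$, $$\int_K\beta(k)\,d\nu_x(k)=\int_{\varOmega}\beta(u(y))\,d\mu(y).$$ Here "integrable" means: $\beta$ is Borel, integrable with respect to $|\nu_x|$ for every $x\in\varOmega$, and $\beta\circ u$ is $\mu$-integrable (in particular all continuous $\beta$ are allowed). A homogeneous Young measure is a Young measure (a weakly$^\ast$ measurable mapping $x\mapsto\nu_x$ from $\varOmega$ to $\mathrm{rca}(K)$ with values in $\mathrm{rca}^1(K)$) which is constant, $\nu_x=\nu$ for all $x\in\varOmega$. It is associated with $u$ if for every continuous $\beta\colon K\to\mathbb{R}$ $$\int_K\beta(k)\,d\nu(k)=\int_{\varOmega}\beta(u(x))\,d\mu(x).$$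 *)

theory Defs
  imports "HOL-Analysis.Analysis"
begin

abbreviation borel_on :: "'a::topological_space set \<Rightarrow> 'a measure"
  where "borel_on K \<equiv> restrict_space borel K"

definition finite_partitions :: "'a measure \<Rightarrow> 'a set \<Rightarrow> 'a set set set"
  where "finite_partitions S A = {P. finite P \<and> disjoint P \<and> P \<subseteq> sets S \<and> \<Union>P = A}"

text \<open>
  Real-valued set functions on the Borel sets of \<open>K\<close> are modelled by total functions on
  \<open>'a set\<close>. The total variation is taken over finite Borel partitions; it is
  extended-real valued, so that no finiteness is presupposed.
\<close>

definition variation :: "'a::topological_space set \<Rightarrow> ('a set \<Rightarrow> real) \<Rightarrow> 'a set \<Rightarrow> ennreal"
  where "variation K \<nu> A =
    (SUP P \<in> finite_partitions (borel_on K) A. \<Sum>B\<in>P. ennreal \<bar>\<nu> B\<bar>)"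

definition signed_measure_on :: "'a::topological_space set \<Rightarrow> ('a set \<Rightarrow> real) \<Rightarrow> bool"
  where "signed_measure_on K \<nu> \<longleftrightarrow>
    (\<forall>A :: nat \<Rightarrow> 'a set. range A \<subseteq> sets (borel_on K) \<longrightarrow> disjoint_family A \<longrightarrow>
      (\<lambda>n. \<nu> (A n)) sums \<nu> (\<Union>n. A n))"

definition regular_on :: "'a::topological_space set \<Rightarrow> ('a set \<Rightarrow> real) \<Rightarrow> bool"
  where "regular_on K \<nu> \<longleftrightarrow>
    (\<forall>A \<in> sets (borel_on K). \<forall>\<epsilon>::real > 0. \<exists>C U.
      closedin (top_of_set K) C \<and> openin (top_of_set K) U \<and>
      C \<subseteq> A \<and> A \<subseteq> U \<and> variation K \<nu> (U - C) < ennreal \<epsilon>)"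

text \<open>
  Members of \<open>rca K\<close> are normalised to be \<open>0\<close> off the Borel sets of \<open>K\<close>, so that equality of
  functions is equality of measures.
\<close>

definition rca :: "'a::topological_space set \<Rightarrow> ('a set \<Rightarrow> real) set"
  where "rca K = {\<nu>. signed_measure_on K \<nu> \<and> regular_on K \<nu> \<and>
    (\<forall>A. A \<notin> sets (borel_on K) \<longrightarrow> \<nu> A = 0)}"

definition rca1 :: "'a::topological_space set \<Rightarrow> ('a set \<Rightarrow> real) set"
  where "rca1 K = {\<nu> \<in> rca K. (\<forall>A \<in> sets (borel_on K). 0 \<le> \<nu> A) \<and> \<nu> K = 1}"

definition variation_measure :: "'a::topological_space set \<Rightarrow> ('a set \<Rightarrow> real) \<Rightarrow> 'a measure"
  where "variation_measure K \<nu> = measure_of K (sets (borel_on K)) (variation K \<nu>)"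

text \<open>
  The positive part of the Jordan decomposition, as the upper variation
  \<open>A \<mapsto> sup {\<nu> B | B \<subseteq> A Borel}\<close>. Since \<open>B = {}\<close> is allowed, the truncation of
  negative values by \<open>ennreal\<close> does not affect the supremum. The negative part is the
  positive part of \<open>- \<nu>\<close>.
\<close>

definition positive_part :: "'a::topological_space set \<Rightarrow> ('a set \<Rightarrow> real) \<Rightarrow> 'a measure"
  where "positive_part K \<nu> = measure_of K (sets (borel_on K))
    (\<lambda>A. SUP B \<in> {B \<in> sets (borel_on K). B \<subseteq> A}. ennreal (\<nu> B))"

definition negative_part :: "'a::topological_space set \<Rightarrow> ('a set \<Rightarrow> real) \<Rightarrow> 'a measure"
  where "negative_part K \<nu> = positive_part K (\<lambda>A. - \<nu> A)"

definition signed_integral ::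
    "'a::topological_space set \<Rightarrow> ('a set \<Rightarrow> real) \<Rightarrow> ('a \<Rightarrow> real) \<Rightarrow> real"
  where "signed_integral K \<nu> \<beta> =
    (\<integral>k. \<beta> k \<partial>positive_part K \<nu>) - (\<integral>k. \<beta> k \<partial>negative_part K \<nu>)"

definition normalized_lebesgue :: "'a::euclidean_space set \<Rightarrow> 'a measure"
  where "normalized_lebesgue \<Omega> =
    density (lebesgue_on \<Omega>) (\<lambda>_. ennreal (1 / measure lebesgue \<Omega>))"

text \<open>
  A family \<open>(\<nu>\<^sub>x)\<close> indexed by \<open>x \<in> \<Omega>\<close> is a total function of which only the values on \<open>\<Omega>\<close>
  matter; likewise test functions \<open>\<beta>\<close> only matter on \<open>K\<close>.
\<close>

definition admissible_test ::
    "'a::euclidean_space set \<Rightarrow> 'b::euclidean_space set \<Rightarrow> ('a \<Rightarrow> 'b) \<Rightarrow>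
     ('a \<Rightarrow> 'b set \<Rightarrow> real) \<Rightarrow> ('b \<Rightarrow> real) \<Rightarrow> bool"
  where "admissible_test \<Omega> K u \<nu> \<beta> \<longleftrightarrow>
    \<beta> \<in> borel_measurable (borel_on K) \<and>
    (\<forall>x\<in>\<Omega>. integrable (variation_measure K (\<nu> x)) \<beta>) \<and>
    integrable (normalized_lebesgue \<Omega>) (\<lambda>y. \<beta> (u y))"

definition quasi_young_measure_of ::
    "'a::euclidean_space set \<Rightarrow> 'b::euclidean_space set \<Rightarrow> ('a \<Rightarrow> 'b) \<Rightarrow>
     ('a \<Rightarrow> 'b set \<Rightarrow> real) \<Rightarrow> bool"
  where "quasi_young_measure_of \<Omega> K u \<nu> \<longleftrightarrow>
    (\<forall>x\<in>\<Omega>. \<nu> x \<in> rca K) \<and>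
    (\<forall>x\<in>\<Omega>. \<forall>\<beta>. admissible_test \<Omega> K u \<nu> \<beta> \<longrightarrow>
      signed_integral K (\<nu> x) \<beta> = (\<integral>y. \<beta> (u y) \<partial>normalized_lebesgue \<Omega>))"

text \<open>
  Weak* measurability refers to the duality of \<open>rca K\<close> with the continuous functions on \<open>K\<close>.
\<close>

definition weakly_star_measurable ::
    "'a::euclidean_space set \<Rightarrow> 'b::euclidean_space set \<Rightarrow> ('a \<Rightarrow> 'b set \<Rightarrow> real) \<Rightarrow> bool"
  where "weakly_star_measurable \<Omega> K \<nu> \<longleftrightarrow>
    (\<forall>\<beta> :: 'b \<Rightarrow> real. continuous_on K \<beta> \<longrightarrow>
      (\<lambda>x. signed_integral K (\<nu> x) \<beta>) \<in> borel_measurable (lebesgue_on \<Omega>))"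

definition young_measure ::
    "'a::euclidean_space set \<Rightarrow> 'b::euclidean_space set \<Rightarrow> ('a \<Rightarrow> 'b set \<Rightarrow> real) \<Rightarrow> bool"
  where "young_measure \<Omega> K \<nu> \<longleftrightarrow>
    (\<forall>x\<in>\<Omega>. \<nu> x \<in> rca1 K) \<and> weakly_star_measurable \<Omega> K \<nu>"

definition homogeneous_young_measure_of ::
    "'a::euclidean_space set \<Rightarrow> 'b::euclidean_space set \<Rightarrow> ('a \<Rightarrow> 'b) \<Rightarrow>
     ('a \<Rightarrow> 'b set \<Rightarrow> real) \<Rightarrow> bool"
  where "homogeneous_young_measure_of \<Omega> K u \<nu> \<longleftrightarrow>
    young_measure \<Omega> K \<nu> \<and>
    (\<exists>\<nu>\<^sub>0. (\<forall>x\<in>\<Omega>. \<nu> x = \<nu>\<^sub>0) \<and>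
      (\<forall>\<beta> :: 'b \<Rightarrow> real. continuous_on K \<beta> \<longrightarrow>
        signed_integral K \<nu>\<^sub>0 \<beta> = (\<integral>y. \<beta> (u y) \<partial>normalized_lebesgue \<Omega>)))"

end

theory Submission
  imports Defs
begin

text \<open>
  Indicator functions of Borel sets are integrable for every finite measure, so testing a
  quasi-Young measure with them gives \<open>\<nu>\<^sub>x A = \<mu> (u\<^sup>-\<^sup>1 A)\<close>: each \<open>\<nu>\<^sub>x\<close> is the push-forward
  of \<open>\<mu>\<close> under \<open>u\<close>, a probability measure not depending on \<open>x\<close>. Since the integral against
  a signed measure is defined by its positive and negative parts, this needs the Jordan
  decomposition and the finiteness of the total variation. Conversely, a homogeneous
  Young measure agrees with the push-forward on continuous functions; finite Borel measures
  are determined by these, because indicators of closed sets are bounded pointwise limits of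
  continuous functions, and integrals transform under push-forward for all Borel \<open>\<beta>\<close>.
\<close>

section \<open>Jordan decomposition of signed measures\<close>

lemma carrier_in_borel_on: "K \<in> sets (borel_on K)"
  using sets.top[of "borel_on K"] by (simp add: space_restrict_space)

lemma signed_measure_on_uminus:
  "signed_measure_on K \<nu> \<Longrightarrow> signed_measure_on K (\<lambda>A. - \<nu> A)"
  unfolding signed_measure_on_def by (auto intro!: sums_minus)

text \<open>The constant sequence \<open>{}\<close> is a disjoint family, and a constant series
  converges only if its terms vanish.\<close>

lemma signed_measure_on_empty:
  assumes "signed_measure_on K \<nu>"
  shows "\<nu> {} = 0"
proof -
  have "(\<lambda>n::nat. \<nu> {}) sums \<nu> (\<Union>n::nat. {})"
    using assms unfolding signed_measure_on_def disjoint_family_on_def by fast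
  then have "summable (\<lambda>n::nat. \<nu> {})"
    by (rule sums_summable)
  then show ?thesis
    by (simp only: summable_const_iff)
qed

lemma signed_measure_on_Un:
  assumes \<nu>: "signed_measure_on K \<nu>"
    and A: "A \<in> sets (borel_on K)" and B: "B \<in> sets (borel_on K)" and AB: "A \<inter> B = {}"
  shows "\<nu> (A \<union> B) = \<nu> A + \<nu> B"
proof -
  have "range (binaryset A B) \<subseteq> sets (borel_on K)"
    using A B by (auto simp: range_binaryset_eq)
  moreover have "disjoint_family (binaryset A B)"
    using AB by (auto simp: disjoint_family_on_def binaryset_def)
  ultimately have "(\<lambda>n. \<nu> (binaryset A B n)) sums \<nu> (A \<union> B)"
    using \<nu> unfolding signed_measure_on_def by (metis UN_binaryset_eq)
  moreover have "(\<lambda>n. \<nu> (binaryset A B n)) sums (\<nu> A + \<nu> B)"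
    using signed_measure_on_empty[OF \<nu>] by (rule binaryset_sums)
  ultimately show ?thesis
    by (rule sums_unique2)
qed

lemma signed_measure_on_Diff:
  assumes \<nu>: "signed_measure_on K \<nu>"
    and A: "A \<in> sets (borel_on K)" and B: "B \<in> sets (borel_on K)" and "B \<subseteq> A"
  shows "\<nu> (A - B) = \<nu> A - \<nu> B"
  using signed_measure_on_Un[OF \<nu> B sets.Diff[OF A B]] \<open>B \<subseteq> A\<close>
  by (simp add: Un_absorb1)

text \<open>
  If \<open>\<nu>\<close> is unbounded on the subsets of \<open>A\<close>, then \<open>A\<close> splits into two pieces with \<open>\<bar>\<nu>\<bar> \<ge> 1\<close> of
  which at least one inherits the unboundedness. Iterating on that piece produces disjoint
  sets whose measures do not tend to \<open>0\<close>.
\<close>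

lemma signed_measure_on_bounded:
  assumes \<nu>: "signed_measure_on K \<nu>"
  obtains c where "\<And>A. A \<in> sets (borel_on K) \<Longrightarrow> \<bar>\<nu> A\<bar> \<le> c"
proof -
  define unb where
    "unb A \<longleftrightarrow> A \<in> sets (borel_on K) \<and> (\<forall>c. \<exists>B\<in>sets (borel_on K). B \<subseteq> A \<and> c < \<bar>\<nu> B\<bar>)" for A
  have split: "unb B \<or> unb (A - B)"
    if A: "unb A" and B: "B \<in> sets (borel_on K)" "B \<subseteq> A" for A B
  proof (rule ccontr)
    assume neg: "\<not> (unb B \<or> unb (A - B))"
    have AB: "A - B \<in> sets (borel_on K)"
      using A B unfolding unb_def by blast
    obtain c1 where c1: "\<And>C. C \<in> sets (borel_on K) \<Longrightarrow> C \<subseteq> B \<Longrightarrow> \<bar>\<nu> C\<bar> \<le> c1"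
      using neg B unfolding unb_def by (meson not_le)
    obtain c2 where c2: "\<And>C. C \<in> sets (borel_on K) \<Longrightarrow> C \<subseteq> A - B \<Longrightarrow> \<bar>\<nu> C\<bar> \<le> c2"
      using neg AB unfolding unb_def by (meson not_le)
    \<comment> \<open>If \<open>B\<close> and \<open>A - B\<close> were both bounded, with bounds
      \<open>c1\<close> and \<open>c2\<close>, no subset of \<open>A\<close> could exceed
      \<open>c1 + c2\<close> in absolute value.\<close>
    obtain C where C: "C \<in> sets (borel_on K)" "C \<subseteq> A" "c1 + c2 < \<bar>\<nu> C\<bar>"
      using A unfolding unb_def by blast
    have "\<nu> C = \<nu> (C \<inter> B) + \<nu> (C - B)"
      using signed_measure_on_Un[OF \<nu>, of "C \<inter> B" "C - B"] C B
      by (simp add: Int_Diff_Un Int_Diff_disjoint sets.Int sets.Diff)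
    moreover have "\<bar>\<nu> (C \<inter> B)\<bar> \<le> c1"
      using C B by (intro c1) auto
    moreover have "\<bar>\<nu> (C - B)\<bar> \<le> c2"
      using C B by (intro c2) auto
    ultimately show False
      using C(3) by linarith
  qed
  have step: "\<exists>B. unb B \<and> B \<subseteq> A \<and> 1 \<le> \<bar>\<nu> (A - B)\<bar>" if A: "unb A" for A
  proof -
    \<comment> \<open>Exceeding \<bar>\<nu> A\<bar> by 1 forces absolute value at least 1 on
      \<open>B\<close> and on \<open>A - B\<close>, so whichever of the two stays unbounded, the
      discarded one carries at least 1.\<close>
    obtain B where B: "B \<in> sets (borel_on K)" "B \<subseteq> A" "\<bar>\<nu> A\<bar> + 1 < \<bar>\<nu> B\<bar>"
      using A unfolding unb_def by blast
    have "\<nu> (A - B) = \<nu> A - \<nu> B"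
      using signed_measure_on_Diff[OF \<nu>] A B unfolding unb_def by blast
    then have "1 \<le> \<bar>\<nu> (A - B)\<bar>" "1 \<le> \<bar>\<nu> (A - (A - B))\<bar>"
      using B by (auto simp: double_diff)
    then show ?thesis
      using split[OF A B(1,2)] B(2) by blast
  qed
  have "\<not> unb K"
  proof
    assume "unb K"
    then have "\<exists>A. \<forall>n. unb (A n) \<and> (A (Suc n) \<subseteq> A n \<and> 1 \<le> \<bar>\<nu> (A n - A (Suc n))\<bar>)"
      using step by (intro dependent_nat_choice) blast+
    then obtain A where A: "\<And>n::nat. unb (A n)" "\<And>n. A (Suc n) \<subseteq> A n"
        "\<And>n. 1 \<le> \<bar>\<nu> (A n - A (Suc n))\<bar>"
      by blast
    have dec: "m \<le> n \<Longrightarrow> A n \<subseteq> A m" for m n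
      using A(2) by (rule lift_Suc_antimono_le)
    have "disjoint_family (\<lambda>n. A n - A (Suc n))"
      unfolding disjoint_family_on_def
    proof (intro ballI impI)
      fix m n :: nat
      assume "m \<noteq> n"
      then consider "Suc m \<le> n" | "Suc n \<le> m"
        by linarith
      then show "(A m - A (Suc m)) \<inter> (A n - A (Suc n)) = {}"
        by cases (use dec in blast)+
    qed
    moreover have "range (\<lambda>n. A n - A (Suc n)) \<subseteq> sets (borel_on K)"
      using A(1) unfolding unb_def by blast
    ultimately have "(\<lambda>n. \<nu> (A n - A (Suc n))) sums \<nu> (\<Union>n. A n - A (Suc n))"
      using \<nu> unfolding signed_measure_on_def by blast
    then have "(\<lambda>n. \<nu> (A n - A (Suc n))) \<longlonglongrightarrow> 0"
      by (intro summable_LIMSEQ_zero sums_summable)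
    then have "(\<lambda>n. \<bar>\<nu> (A n - A (Suc n))\<bar>) \<longlonglongrightarrow> 0"
      by (rule tendsto_rabs_zero)
    from LIMSEQ_le_const[OF this, of 1] show False
      using A(3) by auto
  qed
  then obtain c where "\<And>B. B \<in> sets (borel_on K) \<Longrightarrow> B \<subseteq> K \<Longrightarrow> \<bar>\<nu> B\<bar> \<le> c"
    unfolding unb_def using carrier_in_borel_on[of K] by (meson not_le)
  then show thesis
    using that sets.sets_into_space[of _ "borel_on K"] by (auto simp: space_restrict_space)
qed

text \<open>The set function inside \<open>positive_part\<close>, named separately because
  \<open>measure_of\<close> reproduces it only once it is known to be countably additive.\<close>

definition upper_variation :: "'a::topological_space set \<Rightarrow> ('a set \<Rightarrow> real) \<Rightarrow> 'a set \<Rightarrow> ennreal"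
  where "upper_variation K \<nu> A = (SUP B \<in> {B \<in> sets (borel_on K). B \<subseteq> A}. ennreal (\<nu> B))"

lemma positive_part_eq:
  "positive_part K \<nu> = measure_of K (sets (borel_on K)) (upper_variation K \<nu>)"
  unfolding positive_part_def upper_variation_def ..

lemma sigma_algebra_borel_on: "sigma_algebra K (sets (borel_on K))"
  using sets.sigma_algebra_axioms[of "borel_on K"] by (simp add: space_restrict_space)

lemma upper_variation_upper:
  "B \<in> sets (borel_on K) \<Longrightarrow> B \<subseteq> A \<Longrightarrow> ennreal (\<nu> B) \<le> upper_variation K \<nu> A"
  unfolding upper_variation_def by (intro SUP_upper) auto

lemma upper_variation_mono: "A \<subseteq> B \<Longrightarrow> upper_variation K \<nu> A \<le> upper_variation K \<nu> B"
  unfolding upper_variation_def by (intro SUP_subset_mono) auto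

lemma upper_variation_empty:
  assumes "signed_measure_on K \<nu>"
  shows "upper_variation K \<nu> {} = 0"
proof -
  have "{B \<in> sets (borel_on K). B \<subseteq> {}} = {{}}"
    by auto
  then show ?thesis
    by (simp add: upper_variation_def signed_measure_on_empty[OF assms])
qed

text \<open>A Borel subset of \<open>A\<close> and one of \<open>B\<close> are disjoint, so their
  union competes in the supremum for \<open>A \<union> B\<close> with the sum of their
  values.\<close>

lemma upper_variation_superadditive:
  assumes \<nu>: "signed_measure_on K \<nu>" and AB: "A \<inter> B = {}"
  shows "upper_variation K \<nu> A + upper_variation K \<nu> B \<le> upper_variation K \<nu> (A \<union> B)"
proof -
  let ?S = "\<lambda>A. {C \<in> sets (borel_on K). C \<subseteq> A}"
  have ne: "?S C \<noteq> {}" for C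
    by auto
  have "ennreal (\<nu> C) + ennreal (\<nu> D) \<le> upper_variation K \<nu> (A \<union> B)"
    if C: "C \<in> ?S A" and D: "D \<in> ?S B" for C D
  \<comment> \<open>Truncation by \<open>ennreal\<close> is additive only on nonnegative values; if
    one value is nonpositive, its truncation is 0 and the other set competes alone.\<close>
  proof (cases "\<nu> C \<le> 0 \<or> \<nu> D \<le> 0")
    case True
    moreover have "C \<subseteq> A \<union> B" "D \<subseteq> A \<union> B"
      using C D by auto
    ultimately show ?thesis
      using upper_variation_upper[of C K "A \<union> B" \<nu>] upper_variation_upper[of D K "A \<union> B" \<nu>] C D
      by (auto simp: ennreal_neg)
  next
    case False
    have "C \<inter> D = {}"
      using C D AB by auto
    then have "ennreal (\<nu> C) + ennreal (\<nu> D) = ennreal (\<nu> (C \<union> D))"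
      using signed_measure_on_Un[OF \<nu>, of C D] C D False
      by (subst ennreal_plus[symmetric]) auto
    also have "\<dots> \<le> upper_variation K \<nu> (A \<union> B)"
      using C D by (intro upper_variation_upper) auto
    finally show ?thesis .
  qed
  then have "(SUP D\<in>?S B. SUP C\<in>?S A. ennreal (\<nu> C) + ennreal (\<nu> D)) \<le> upper_variation K \<nu> (A \<union> B)"
    by (intro SUP_least)
  then show ?thesis
    unfolding upper_variation_def[of K \<nu> A] upper_variation_def[of K \<nu> B]
    by (simp add: ennreal_SUP_add_left[OF ne] ennreal_SUP_add_right[OF ne])
qed

text \<open>Superadditivity on finite unions bounds the series from above by the value on the union.
  Conversely, a competitor \<open>B\<close> for the union is cut into the pieces
  \<open>B \<inter> A i\<close>, each of which competes for \<open>A i\<close>.\<close>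

lemma upper_variation_countably_additive:
  assumes \<nu>: "signed_measure_on K \<nu>"
  shows "countably_additive (sets (borel_on K)) (upper_variation K \<nu>)"
  unfolding countably_additive_def
proof (intro allI impI antisym)
  fix A :: "nat \<Rightarrow> 'a set"
  assume A: "range A \<subseteq> sets (borel_on K)" "disjoint_family A"
  have "(\<Sum>i<n. upper_variation K \<nu> (A i)) \<le> upper_variation K \<nu> (\<Union>i<n. A i)" for n
  proof (induction n)
    case (Suc n)
    have "A i \<inter> A n = {}" if "i < n" for i
      using A(2) that by (intro disjoint_family_onD) auto
    then have disj: "(\<Union>i<n. A i) \<inter> A n = {}"
      by blast
    have "(\<Sum>i<Suc n. upper_variation K \<nu> (A i)) \<le>
        upper_variation K \<nu> (\<Union>i<n. A i) + upper_variation K \<nu> (A n)"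
      using add_right_mono[OF Suc] by simp
    also have "\<dots> \<le> upper_variation K \<nu> ((\<Union>i<n. A i) \<union> A n)"
      using \<nu> disj by (rule upper_variation_superadditive)
    also have "(\<Union>i<n. A i) \<union> A n = (\<Union>i<Suc n. A i)"
      by (auto simp: less_Suc_eq)
    finally show ?case .
  qed simp
  also have "upper_variation K \<nu> (\<Union>i<n. A i) \<le> upper_variation K \<nu> (\<Union>i. A i)" for n
    by (intro upper_variation_mono) auto
  finally show "(\<Sum>i. upper_variation K \<nu> (A i)) \<le> upper_variation K \<nu> (\<Union>i. A i)"
    by (simp add: suminf_eq_SUP SUP_least)
  show "upper_variation K \<nu> (\<Union>i. A i) \<le> (\<Sum>i. upper_variation K \<nu> (A i))"
    unfolding upper_variation_def[of K \<nu> "\<Union>i. A i"]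
  proof (rule SUP_least)
    fix B assume "B \<in> {B \<in> sets (borel_on K). B \<subseteq> (\<Union>i. A i)}"
    then have B: "B \<in> sets (borel_on K)" "B = (\<Union>i. B \<inter> A i)"
      by auto
    have "range (\<lambda>i. B \<inter> A i) \<subseteq> sets (borel_on K)" "disjoint_family (\<lambda>i. B \<inter> A i)"
      using A B(1) by (auto simp: disjoint_family_on_def)
    then have "(\<lambda>i. \<nu> (B \<inter> A i)) sums \<nu> B"
      using \<nu> B(2) unfolding signed_measure_on_def by metis
    then have "(\<lambda>n. ennreal (\<Sum>i<n. \<nu> (B \<inter> A i))) \<longlonglongrightarrow> ennreal (\<nu> B)"
      unfolding sums_def by (rule tendsto_ennrealI)
    moreover have "ennreal (\<Sum>i<n. \<nu> (B \<inter> A i)) \<le> (\<Sum>i. upper_variation K \<nu> (A i))" for n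
    proof -
      \<comment> \<open>Negative terms are raised to 0, which can only increase the sum and lets
        \<open>ennreal\<close> pass inside it.\<close>
      have "ennreal (\<Sum>i<n. \<nu> (B \<inter> A i)) \<le> ennreal (\<Sum>i<n. max 0 (\<nu> (B \<inter> A i)))"
        by (intro ennreal_leI sum_mono) auto
      also have "\<dots> = (\<Sum>i<n. ennreal (\<nu> (B \<inter> A i)))"
        by (subst sum_ennreal[symmetric]) (simp_all add: ennreal_max_0 del: sum_ennreal)
      also have "\<dots> \<le> (\<Sum>i<n. upper_variation K \<nu> (A i))"
        using A(1) B(1) by (intro sum_mono upper_variation_upper) auto
      also have "\<dots> \<le> (\<Sum>i. upper_variation K \<nu> (A i))"
        by (intro sum_le_suminf) auto
      finally show ?thesis .
    qed
    ultimately show "ennreal (\<nu> B) \<le> (\<Sum>i. upper_variation K \<nu> (A i))"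
      by (intro LIMSEQ_le_const2) auto
  qed
qed

lemma upper_variation_finite:
  assumes "signed_measure_on K \<nu>"
  shows "upper_variation K \<nu> A < \<infinity>"
proof -
  obtain c where "\<And>A. A \<in> sets (borel_on K) \<Longrightarrow> \<bar>\<nu> A\<bar> \<le> c"
    using signed_measure_on_bounded[OF assms] by blast
  then have "upper_variation K \<nu> A \<le> ennreal c"
    unfolding upper_variation_def by (intro SUP_least ennreal_leI) (auto dest: abs_le_D1)
  then show ?thesis
    by (simp add: le_less_trans)
qed

lemma sets_positive_part: "sets (positive_part K \<nu>) = sets (borel_on K)"
  unfolding positive_part_eq
  by (rule sigma_algebra.sets_measure_of_eq[OF sigma_algebra_borel_on])

lemma space_positive_part: "space (positive_part K \<nu>) = K"
  using sets_eq_imp_space_eq[OF sets_positive_part] by (simp add: space_restrict_space)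

lemma emeasure_positive_part:
  assumes "signed_measure_on K \<nu>" and "A \<in> sets (borel_on K)"
  shows "emeasure (positive_part K \<nu>) A = upper_variation K \<nu> A"
  unfolding positive_part_eq using assms
  by (intro emeasure_measure_of_sigma sigma_algebra_borel_on upper_variation_countably_additive)
    (simp_all add: positive_def upper_variation_empty)

lemma finite_measure_positive_part:
  assumes "signed_measure_on K \<nu>"
  shows "finite_measure (positive_part K \<nu>)"
proof
  show "emeasure (positive_part K \<nu>) (space (positive_part K \<nu>)) \<noteq> \<infinity>"
    using upper_variation_finite[OF assms, of K]
    by (simp add: space_positive_part emeasure_positive_part assms carrier_in_borel_on)
qed

text \<open>Subtraction-free form of \<open>\<nu> = \<nu>\<^sup>+ - \<nu>\<^sup>-\<close> in \<^typ>\<open>ennreal\<close>; the reverse inequality is the case of \<open>- \<nu>\<close>.\<close>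

lemma upper_variation_uminus_le:
  assumes \<nu>: "signed_measure_on K \<nu>" and A: "A \<in> sets (borel_on K)"
  shows "upper_variation K \<nu> A + ennreal (- \<nu> A) \<le>
    upper_variation K (\<lambda>A. - \<nu> A) A + ennreal (\<nu> A)"
proof -
  let ?S = "{B \<in> sets (borel_on K). B \<subseteq> A}" and ?Q = "upper_variation K (\<lambda>A. - \<nu> A) A"
  have "?S \<noteq> {}"
    by auto
  have "ennreal (\<nu> B) + ennreal (- \<nu> A) \<le> ?Q + ennreal (\<nu> A)" if "B \<in> ?S" for B
  proof -
    have B: "B \<in> sets (borel_on K)" "B \<subseteq> A"
      using that by auto
    have QA: "ennreal (- \<nu> A) \<le> ?Q"
      using upper_variation_upper[OF A order_refl, where \<nu>="\<lambda>A. - \<nu> A"] .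
    \<comment> \<open>Here \<open>A - B\<close> is the competitor for \<open>- \<nu>\<close>: its
      value under \<open>- \<nu>\<close> is \<open>\<nu> B - \<nu> A\<close>.\<close>
    have QB: "ennreal (\<nu> B - \<nu> A) \<le> ?Q"
      using upper_variation_upper[of "A - B" K A "\<lambda>A. - \<nu> A"] A B
      by (auto simp: signed_measure_on_Diff[OF \<nu> A B])
    \<comment> \<open>In the first two cases one summand on the left truncates to 0; in the third
      both are positive and add up to the value in \<open>QB\<close>.\<close>
    consider "\<nu> B \<le> 0" | "0 \<le> \<nu> A" | "0 < \<nu> B" "\<nu> A < 0"
      by linarith
    then show ?thesis
    proof cases
      case 1
      then show ?thesis
        using QA by (simp add: ennreal_neg add_increasing2)
    next
      case 2
      have "ennreal (\<nu> B) \<le> ennreal (max 0 (\<nu> B - \<nu> A) + \<nu> A)"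
        by (intro ennreal_leI) auto
      also have "\<dots> = ennreal (\<nu> B - \<nu> A) + ennreal (\<nu> A)"
        using 2 by (simp add: ennreal_plus max_def ennreal_neg)
      finally show ?thesis
        using 2 QB by (simp add: ennreal_neg) (meson add_right_mono order_trans)
    next
      case 3
      then have "ennreal (\<nu> B) + ennreal (- \<nu> A) = ennreal (\<nu> B - \<nu> A)"
        by (subst ennreal_plus[symmetric]) auto
      then show ?thesis
        using QB by (simp add: add_increasing2)
    qed
  qed
  then have "(SUP B\<in>?S. ennreal (\<nu> B) + ennreal (- \<nu> A)) \<le> ?Q + ennreal (\<nu> A)"
    by (rule SUP_least)
  then show ?thesis
    unfolding upper_variation_def[of K \<nu> A] by (simp add: ennreal_SUP_add_left[OF \<open>?S \<noteq> {}\<close>])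
qed

lemma jordan_decomposition:
  assumes \<nu>: "signed_measure_on K \<nu>" and A: "A \<in> sets (borel_on K)"
  shows "\<nu> A = measure (positive_part K \<nu>) A - measure (negative_part K \<nu>) A"
proof -
  note neg = signed_measure_on_uminus[OF \<nu>]
  have "upper_variation K \<nu> A + ennreal (- \<nu> A) = upper_variation K (\<lambda>A. - \<nu> A) A + ennreal (\<nu> A)"
    using upper_variation_uminus_le[OF \<nu> A] upper_variation_uminus_le[OF neg A]
    by (intro antisym) auto
  \<comment> \<open>Passing to real numbers keeps the sums because all four terms are
    finite.\<close>
  then have "enn2real (upper_variation K \<nu> A) + enn2real (ennreal (- \<nu> A)) =
      enn2real (upper_variation K (\<lambda>A. - \<nu> A) A) + enn2real (ennreal (\<nu> A))"
    using upper_variation_finite[OF \<nu>, of A] upper_variation_finite[OF neg, of A]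
    by (simp flip: enn2real_plus)
  then show ?thesis
    unfolding negative_part_def measure_def emeasure_positive_part[OF \<nu> A]
      emeasure_positive_part[OF neg A]
    by (cases "0 \<le> \<nu> A") (auto simp: ennreal_neg)
qed

text \<open>Reduces to the Jordan decomposition; through it, an identity for integrals yields the
  values of the measure itself.\<close>

lemma signed_integral_indicator:
  assumes "signed_measure_on K \<nu>" and "A \<in> sets (borel_on K)"
  shows "signed_integral K \<nu> (indicator A) = \<nu> A"
  using jordan_decomposition[OF assms] assms(2) sets.sets_into_space[OF assms(2)]
  by (simp add: signed_integral_def negative_part_def space_positive_part space_restrict_space
      Int_absorb2)

text \<open>Nonnegativity makes \<open>\<nu>\<close> monotone, so the supremum is attained at
  \<open>A\<close>; for \<open>- \<nu>\<close> every competitor truncates to 0.\<close>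

lemma upper_variation_nonneg:
  assumes \<nu>: "signed_measure_on K \<nu>" and nonneg: "\<And>A. A \<in> sets (borel_on K) \<Longrightarrow> 0 \<le> \<nu> A"
    and A: "A \<in> sets (borel_on K)"
  shows "upper_variation K \<nu> A = ennreal (\<nu> A)" "upper_variation K (\<lambda>A. - \<nu> A) A = 0"
proof -
  have "\<nu> B \<le> \<nu> A" if "B \<in> sets (borel_on K)" "B \<subseteq> A" for B
    using signed_measure_on_Diff[OF \<nu> A that] nonneg[of "A - B"] A that by auto
  then show "upper_variation K \<nu> A = ennreal (\<nu> A)"
    using A by (intro antisym upper_variation_upper)
      (auto simp: upper_variation_def intro!: SUP_least ennreal_leI)
  have "upper_variation K (\<lambda>A. - \<nu> A) A \<le> 0"
    unfolding upper_variation_def using nonneg by (intro SUP_least) (auto simp: ennreal_neg)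
  then show "upper_variation K (\<lambda>A. - \<nu> A) A = 0"
    by simp
qed

text \<open>The negative part is the null measure, against which every function is 0 almost
  everywhere and so has integral 0.\<close>

lemma signed_integral_nonneg:
  assumes \<nu>: "signed_measure_on K \<nu>" and nonneg: "\<And>A. A \<in> sets (borel_on K) \<Longrightarrow> 0 \<le> \<nu> A"
  shows "signed_integral K \<nu> \<beta> = (\<integral>k. \<beta> k \<partial>positive_part K \<nu>)"
proof -
  have "negative_part K \<nu> = null_measure (borel_on K)"
    unfolding negative_part_def using nonneg
    by (intro measure_eqI)
      (auto simp: sets_positive_part emeasure_positive_part signed_measure_on_uminus[OF \<nu>]
        upper_variation_nonneg[OF \<nu> nonneg])
  moreover have "integral\<^sup>L (null_measure (borel_on K)) \<beta> = 0"
    by (intro integral_eq_zero_AE) (auto simp: AE_iff_null null_sets_def eventually_ae_filter)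
  ultimately show ?thesis
    by (simp add: signed_integral_def)
qed

section \<open>The total variation\<close>

text \<open>On each block, \<bar>\<nu> B\<bar> is at most the sum of the two upper variations, and
  these are additive over the partition. This is how the total variation is seen to be
  finite.\<close>

lemma variation_le:
  assumes \<nu>: "signed_measure_on K \<nu>"
  shows "variation K \<nu> A \<le> upper_variation K \<nu> A + upper_variation K (\<lambda>A. - \<nu> A) A"
  unfolding variation_def
proof (rule SUP_least)
  note neg = signed_measure_on_uminus[OF \<nu>]
  let ?P = "upper_variation K \<nu>" and ?Q = "upper_variation K (\<lambda>A. - \<nu> A)"
  fix P assume "P \<in> finite_partitions (borel_on K) A"
  then have P: "finite P" "disjoint P" "P \<subseteq> sets (borel_on K)" "\<Union>P = A"
    by (auto simp: finite_partitions_def)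
  \<comment> \<open>A set with a finite Borel partition is itself Borel, being a finite union of
    blocks.\<close>
  have "A \<in> sets (borel_on K)"
    using P by (metis sets.finite_Union)
  have abs: "ennreal \<bar>\<nu> B\<bar> \<le> ?P B + ?Q B" if "B \<in> sets (borel_on K)" for B
    using upper_variation_upper[OF that order_refl, of \<nu>]
      upper_variation_upper[OF that order_refl, of "\<lambda>A. - \<nu> A"]
    by (cases "0 \<le> \<nu> B") (auto simp: add_increasing add_increasing2)
  have sum: "(\<Sum>B\<in>P. upper_variation K \<mu> B) = upper_variation K \<mu> A"
    if "signed_measure_on K \<mu>" for \<mu>
  proof -
    have "(\<Sum>B\<in>P. emeasure (positive_part K \<mu>) B) = emeasure (positive_part K \<mu>) (\<Union>B\<in>P. B)"
      using P by (intro sum_emeasure) (auto simp: sets_positive_part disjoint_family_on_def disjoint_def)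
    then show ?thesis
      using P(3,4) that \<open>A \<in> sets (borel_on K)\<close> 
      by (simp add: emeasure_positive_part subset_iff)
  qed
  have "(\<Sum>B\<in>P. ennreal \<bar>\<nu> B\<bar>) \<le> (\<Sum>B\<in>P. ?P B + ?Q B)"
    using P(3) abs by (intro sum_mono) auto
  also have "\<dots> = ?P A + ?Q A"
    by (simp add: sum.distrib sum[OF \<nu>] sum[OF neg])
  finally show "(\<Sum>B\<in>P. ennreal \<bar>\<nu> B\<bar>) \<le> ?P A + ?Q A" .
qed

lemma sets_variation_measure: "sets (variation_measure K \<nu>) = sets (borel_on K)"
  unfolding variation_measure_def
  by (rule sigma_algebra.sets_measure_of_eq[OF sigma_algebra_borel_on])

lemma finite_measure_variation_measure:
  assumes \<nu>: "signed_measure_on K \<nu>"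
  shows "finite_measure (variation_measure K \<nu>)"
proof
  \<comment> \<open>\<open>measure_of\<close> assigns to a set either the prescribed value or 0, so
    this bound holds before countable additivity of the variation is established.\<close>
  have "emeasure (variation_measure K \<nu>) A \<le> variation K \<nu> A" for A
    unfolding variation_measure_def by (simp add: emeasure_measure_of_conv)
  also have "variation K \<nu> A < \<infinity>" for A
    using variation_le[OF \<nu>, of A] upper_variation_finite[OF \<nu>, of A]
      upper_variation_finite[OF signed_measure_on_uminus[OF \<nu>], of A]
    by (simp add: le_less_trans)
  finally show "emeasure (variation_measure K \<nu>) (space (variation_measure K \<nu>)) \<noteq> \<infinity>"
    by (metis less_irrefl)
qed

section \<open>Uniqueness of finite Borel measures\<close>

text \<open>The indicator of \<open>C\<close> is the pointwise limit of continuous functions equal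
  to 1 on \<open>C\<close> and decreasing linearly with the distance to \<open>C\<close>. They are
  dominated by 1, which is integrable for a finite measure, so the integrals converge to the measure
  of \<open>K \<inter> C\<close>.\<close>

lemma measure_closed_eqI_continuous:
  fixes K C :: "'a::metric_space set"
  assumes M: "sets M = sets (borel_on K)" "finite_measure M"
    and N: "sets N = sets (borel_on K)" "finite_measure N"
    and eq: "\<And>\<beta>::'a \<Rightarrow> real. continuous_on K \<beta> \<Longrightarrow> (\<integral>k. \<beta> k \<partial>M) = (\<integral>k. \<beta> k \<partial>N)"
    and C: "closed C"
  shows "measure M (K \<inter> C) = measure N (K \<inter> C)"
\<comment> \<open>The empty set is treated apart: \<open>infdist\<close> to it is 0 by convention,
  so the functions \<open>f n\<close> would be constantly 1.\<close>
proof (cases "C = {}")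
  case False
  define f where "f n x = max 0 (1 - real n * infdist x C)" for n :: nat and x
  have cont: "continuous_on UNIV (f n)" for n
    unfolding f_def by (intro continuous_intros continuous_on_infdist)
  have lim: "(\<lambda>n. f n x) \<longlonglongrightarrow> indicator C x" for x
  proof (cases "x \<in> C")
    case True
    then show ?thesis
      by (simp add: f_def)
  next
    case False
    \<comment> \<open>Closedness makes the distance positive, so \<open>f n x\<close> is exactly 0
      once \<open>n\<close> exceeds its reciprocal.\<close>
    then have "0 < infdist x C"
      using C \<open>C \<noteq> {}\<close> by (simp add: infdist_pos_not_in_closed)
    obtain m :: nat where m: "1 / infdist x C < real m"
      using reals_Archimedean2 by blast
    have "f n x = 0" if "m \<le> n" for n
    proof -
      have "1 / infdist x C < real n"
        using m that by linarith
      then show ?thesis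
        using \<open>0 < infdist x C\<close> by (simp add: f_def divide_less_eq)
    qed
    then have "eventually (\<lambda>n. f n x = 0) sequentially"
      by (auto simp: eventually_sequentially)
    then show ?thesis
      using False by (simp add: tendsto_eventually)
  qed
  have int: "(\<lambda>n. \<integral>x. f n x \<partial>L) \<longlonglongrightarrow> measure L (K \<inter> C)"
    if L: "sets L = sets (borel_on K)" "finite_measure L" for L
  proof -
    interpret finite_measure L by fact
    have space: "space L = K"
      using sets_eq_imp_space_eq[OF L(1)] by (simp add: space_restrict_space)
    have meas: "g \<in> borel_measurable L" if "g \<in> borel_measurable borel" for g :: "'a \<Rightarrow> real"
      using that by (simp add: measurable_cong_sets[OF L(1) refl] measurable_restrict_space1)
    have "(\<lambda>n. \<integral>x. f n x \<partial>L) \<longlonglongrightarrow> (\<integral>x. indicator C x \<partial>L)"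
    proof (rule integral_dominated_convergence[where w="\<lambda>_. 1"])
      show "(indicator C :: 'a \<Rightarrow> real) \<in> borel_measurable L"
        using C by (intro meas) simp
      show "f n \<in> borel_measurable L" for n
        using cont by (intro meas borel_measurable_continuous_onI)
      show "AE x in L. norm (f n x) \<le> 1" for n
        by (auto simp: f_def infdist_nonneg)
    qed (use lim in auto)
    then show ?thesis
      by (simp add: space Int_commute)
  qed
  have "(\<integral>x. f n x \<partial>M) = (\<integral>x. f n x \<partial>N)" for n
    using cont by (intro eq) (blast intro: continuous_on_subset)
  then show ?thesis
    using int[OF M] int[OF N] by (simp add: LIMSEQ_unique)
qed simp

text \<open>Both measures are pushed forward along the inclusion of \<open>K\<close> into the whole
  space. There the closed sets form an intersection-stable generator of the Borel sets, and the
  whole space has finite mass, so agreement on closed sets suffices.\<close>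

lemma finite_measure_eqI_continuous:
  fixes K :: "'a::metric_space set"
  assumes M: "sets M = sets (borel_on K)" "finite_measure M"
    and N: "sets N = sets (borel_on K)" "finite_measure N"
    and eq: "\<And>\<beta>::'a \<Rightarrow> real. continuous_on K \<beta> \<Longrightarrow> (\<integral>k. \<beta> k \<partial>M) = (\<integral>k. \<beta> k \<partial>N)"
  shows "M = N"
proof -
  interpret M: finite_measure M by fact
  interpret N: finite_measure N by fact
  have spM: "space M = K" and spN: "space N = K"
    using sets_eq_imp_space_eq[OF M(1)] sets_eq_imp_space_eq[OF N(1)]
    by (simp_all add: space_restrict_space)
  have idM: "(\<lambda>x. x) \<in> measurable M borel" and idN: "(\<lambda>x. x) \<in> measurable N borel"
    by (simp_all add: measurable_cong_sets[OF M(1) refl] measurable_cong_sets[OF N(1) refl]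
        measurable_restrict_space1)
  have "distr M borel (\<lambda>x. x) = distr N borel (\<lambda>x. x)"
  proof (rule measure_eqI_generator_eq[where E="Collect closed" and \<Omega>=UNIV and A="\<lambda>_. UNIV"])
    show "Int_stable (Collect closed :: 'a set set)"
      by (auto simp: Int_stable_def)
    show "emeasure (distr M borel (\<lambda>x. x)) X = emeasure (distr N borel (\<lambda>x. x)) X"
      if "X \<in> Collect closed" for X
      using measure_closed_eqI_continuous[OF M N eq, of X] that
      by (simp add: emeasure_distr[OF idM] emeasure_distr[OF idN] spM spN
          M.emeasure_eq_measure N.emeasure_eq_measure Int_commute)
    show "emeasure (distr M borel (\<lambda>x. x)) UNIV \<noteq> \<infinity>"
      by (simp add: emeasure_distr[OF idM])
  qed (auto simp: borel_eq_closed)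
  then have *: "emeasure M (A \<inter> K) = emeasure N (A \<inter> K)" if "A \<in> sets borel" for A
    using that emeasure_distr[OF idM that] emeasure_distr[OF idN that] by (simp add: spM spN)
  show ?thesis
    using M(1) N(1) * by (intro measure_eqI) (auto simp: sets_restrict_space Int_commute)
qed

section \<open>Push-forward of the normalized Lebesgue measure\<close>

lemma sets_normalized_lebesgue: "sets (normalized_lebesgue \<Omega>) = sets (lebesgue_on \<Omega>)"
  by (simp add: normalized_lebesgue_def)

lemma space_normalized_lebesgue: "space (normalized_lebesgue \<Omega>) = \<Omega>"
  by (simp add: normalized_lebesgue_def space_restrict_space)

lemma emeasure_normalized_lebesgue_space:
  assumes "\<Omega> \<in> sets lebesgue" and "emeasure lebesgue \<Omega> = ennreal M" and "0 < M"
  shows "emeasure (normalized_lebesgue \<Omega>) \<Omega> = 1"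
proof -
  have "measure lebesgue \<Omega> = M"
    using assms by (simp add: measure_def)
  moreover have "emeasure (lebesgue_on \<Omega>) \<Omega> = ennreal M"
    using assms by (simp add: emeasure_restrict_space)
  moreover have "\<Omega> \<in> sets (lebesgue_on \<Omega>)"
    using sets.top[of "lebesgue_on \<Omega>"] by (simp add: space_restrict_space)
  ultimately show ?thesis
    using assms(3) unfolding normalized_lebesgue_def
    by (simp add: emeasure_density_const flip: ennreal_mult)
qed

text \<open>A bounded Borel function is integrable for every finite measure, hence an admissible
  test. This serves both indicators and, by compactness of \<open>K\<close>, continuous
  functions.\<close>

lemma quasi_young_measure_of_apply:
  assumes fin: "finite_measure (normalized_lebesgue \<Omega>)"
    and u: "u \<in> lebesgue_on \<Omega> \<rightarrow>\<^sub>M borel_on K"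
    and q: "quasi_young_measure_of \<Omega> K u \<nu>" and x: "x \<in> \<Omega>"
    and \<beta>: "\<beta> \<in> borel_measurable (borel_on K)" and bdd: "\<And>k. k \<in> K \<Longrightarrow> \<bar>\<beta> k\<bar> \<le> c"
  shows "signed_integral K (\<nu> x) \<beta> = (\<integral>y. \<beta> (u y) \<partial>normalized_lebesgue \<Omega>)"
proof -
  have "integrable (variation_measure K (\<nu> z)) \<beta>" if "z \<in> \<Omega>" for z
  proof -
    have "signed_measure_on K (\<nu> z)"
      using q that by (auto simp: quasi_young_measure_of_def rca_def)
    then interpret finite_measure "variation_measure K (\<nu> z)"
      by (rule finite_measure_variation_measure)
    have "space (variation_measure K (\<nu> z)) = K"
      using sets_eq_imp_space_eq[OF sets_variation_measure] by (simp add: space_restrict_space)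
    then show ?thesis
      using bdd \<beta> by (intro integrable_const_bound[where B=c])
        (auto simp: measurable_cong_sets[OF sets_variation_measure refl])
  qed
  moreover have "integrable (normalized_lebesgue \<Omega>) (\<lambda>y. \<beta> (u y))"
  proof -
    interpret finite_measure "normalized_lebesgue \<Omega>" by fact
    have "u y \<in> K" if "y \<in> \<Omega>" for y
      using measurable_space[OF u, of y] that by (simp add: space_restrict_space)
    then show ?thesis
      using bdd measurable_compose[OF u \<beta>]
      by (intro integrable_const_bound[where B=c])
        (auto simp: measurable_cong_sets[OF sets_normalized_lebesgue refl] space_normalized_lebesgue)
  qed
  ultimately have "admissible_test \<Omega> K u \<nu> \<beta>"
    using \<beta> by (simp add: admissible_test_def)
  then show ?thesis
    using q x by (simp add: quasi_young_measure_of_def)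
qed

section \<open>Equivalence of the two notions\<close>

lemma quasi_young_measure_of_imp_homogeneous:
  fixes \<Omega> :: "'a::euclidean_space set" and K :: "'b::euclidean_space set"
  assumes one: "emeasure (normalized_lebesgue \<Omega>) \<Omega> = 1"
    and K: "compact K"
    and u: "u \<in> lebesgue_on \<Omega> \<rightarrow>\<^sub>M borel_on K"
    and q: "quasi_young_measure_of \<Omega> K u \<nu>"
  shows "homogeneous_young_measure_of \<Omega> K u \<nu>"
proof -
  let ?\<mu> = "normalized_lebesgue \<Omega>"
  have fin: "finite_measure ?\<mu>"
    using one by (intro finite_measureI) (simp add: space_normalized_lebesgue)
  have rca: "\<nu> x \<in> rca K" if "x \<in> \<Omega>" for x
    using q that by (simp add: quasi_young_measure_of_def)
  have uK: "u y \<in> K" if "y \<in> \<Omega>" for y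
    using measurable_space[OF u, of y] that by (simp add: space_restrict_space)
  have val: "\<nu> x A = (\<integral>y. indicator A (u y) \<partial>?\<mu>)" if "x \<in> \<Omega>" "A \<in> sets (borel_on K)" for x A
  proof -
    have "\<nu> x A = signed_integral K (\<nu> x) (indicator A)"
      using rca[OF that(1)] that(2) by (simp add: rca_def signed_integral_indicator)
    also have "\<dots> = (\<integral>y. indicator A (u y) \<partial>?\<mu>)"
      using that
      by (intro quasi_young_measure_of_apply[OF fin u q, where c=1]) (auto simp: indicator_def)
    finally show ?thesis .
  qed
  have one': "\<nu> x K = 1" if "x \<in> \<Omega>" for x
  proof -
    \<comment> \<open>Since \<open>u\<close> maps \<Omega> into \<open>K\<close>, the indicator of
      \<open>K\<close> composed with \<open>u\<close> is 1 on \<Omega>.\<close>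
    have "\<nu> x K = (\<integral>y. 1 \<partial>?\<mu>)"
      unfolding val[OF that carrier_in_borel_on]
      by (intro Bochner_Integration.integral_cong) (auto simp: space_normalized_lebesgue uK)
    then show ?thesis
      using one by (simp add: space_normalized_lebesgue measure_def)
  qed
  \<comment> \<open>By \<open>val\<close> the values are integrals of indicators, hence
    nonnegative.\<close>
  have rca1: "\<nu> x \<in> rca1 K" if "x \<in> \<Omega>" for x
    using rca[OF that] one'[OF that] by (simp add: rca1_def val[OF that])
  have cont: "signed_integral K (\<nu> x) \<beta> = (\<integral>y. \<beta> (u y) \<partial>?\<mu>)"
    if x: "x \<in> \<Omega>" and \<beta>: "continuous_on K \<beta>" for x and \<beta> :: "'b \<Rightarrow> real"
  proof -
    have "bounded (\<beta> ` K)"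
      using K \<beta> by (intro compact_imp_bounded compact_continuous_image)
    then obtain c where "\<And>k. k \<in> K \<Longrightarrow> \<bar>\<beta> k\<bar> \<le> c"
      by (auto simp: bounded_iff)
    then show ?thesis
      using borel_measurable_continuous_on_restrict[OF \<beta>]
      by (intro quasi_young_measure_of_apply[OF fin u q x])
  qed
  \<comment> \<open>By \<open>cont\<close> this function is constant on \<Omega>, hence
    measurable.\<close>
  have "(\<lambda>x. signed_integral K (\<nu> x) \<beta>) \<in> borel_measurable (lebesgue_on \<Omega>)"
    if "continuous_on K \<beta>" for \<beta> :: "'b \<Rightarrow> real"
    using cont[OF _ that] by (subst measurable_cong) (auto simp: space_restrict_space)
  then have young: "young_measure \<Omega> K \<nu>"
    using rca1 by (simp add: young_measure_def weakly_star_measurable_def)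
  \<comment> \<open>A set of mass 1 is nonempty, so some member of the family can serve as the
    common value.\<close>
  obtain x\<^sub>0 where x0: "x\<^sub>0 \<in> \<Omega>"
    using one by fastforce
  \<comment> \<open>On Borel sets both sides are given by \<open>val\<close>, which does not involve
    the index; elsewhere both vanish by the normalisation in \<open>rca\<close>.\<close>
  have "\<nu> x = \<nu> x\<^sub>0" if "x \<in> \<Omega>" for x
  proof
    show "\<nu> x A = \<nu> x\<^sub>0 A" for A
      using rca[OF that] rca[OF x0] val[OF that, of A] val[OF x0, of A]
      by (cases "A \<in> sets (borel_on K)") (auto simp: rca_def)
  qed
  then show ?thesis
    using young cont[OF x0] by (auto simp: homogeneous_young_measure_of_def)
qed

lemma homogeneous_young_measure_of_imp_quasi:
  fixes \<Omega> :: "'a::euclidean_space set" and K :: "'b::euclidean_space set"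
  assumes one: "emeasure (normalized_lebesgue \<Omega>) \<Omega> = 1"
    and u: "u \<in> lebesgue_on \<Omega> \<rightarrow>\<^sub>M borel_on K"
    and h: "homogeneous_young_measure_of \<Omega> K u \<nu>"
  shows "quasi_young_measure_of \<Omega> K u \<nu>"
proof -
  let ?\<mu> = "normalized_lebesgue \<Omega>"
  have fin: "finite_measure ?\<mu>"
    using one by (intro finite_measureI) (simp add: space_normalized_lebesgue)
  have u\<mu>: "u \<in> ?\<mu> \<rightarrow>\<^sub>M borel_on K"
    using u by (simp add: measurable_cong_sets[OF sets_normalized_lebesgue refl])
  have rca1: "\<nu> x \<in> rca1 K" if "x \<in> \<Omega>" for x
    using h that by (simp add: homogeneous_young_measure_of_def young_measure_def)
  have "signed_integral K (\<nu> x) \<beta> = (\<integral>y. \<beta> (u y) \<partial>?\<mu>)"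
    if x: "x \<in> \<Omega>" and \<beta>: "\<beta> \<in> borel_measurable (borel_on K)" for x \<beta>
  proof -
    have \<nu>: "signed_measure_on K (\<nu> x)" and nonneg: "\<And>A. A \<in> sets (borel_on K) \<Longrightarrow> 0 \<le> \<nu> x A"
      using rca1[OF x] by (auto simp: rca1_def rca_def)
    \<comment> \<open>For a nonnegative measure the signed integral is the integral against the
      positive part, so the hypothesis on continuous functions identifies that part with the
      push-forward. The change of variables then applies to every Borel test function.\<close>
    have "positive_part K (\<nu> x) = distr ?\<mu> (borel_on K) u"
    proof (rule finite_measure_eqI_continuous)
      show "finite_measure (positive_part K (\<nu> x))"
        using \<nu> by (rule finite_measure_positive_part)
      show "finite_measure (distr ?\<mu> (borel_on K) u)"
        using fin u\<mu> by (rule finite_measure.finite_measure_distr)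
      fix \<gamma> :: "'b \<Rightarrow> real" assume \<gamma>: "continuous_on K \<gamma>"
      have "(\<integral>k. \<gamma> k \<partial>positive_part K (\<nu> x)) = signed_integral K (\<nu> x) \<gamma>"
        using signed_integral_nonneg[OF \<nu> nonneg] by simp
      also have "\<dots> = (\<integral>y. \<gamma> (u y) \<partial>?\<mu>)"
        using h x \<gamma> by (auto simp: homogeneous_young_measure_of_def)
      also have "\<dots> = (\<integral>k. \<gamma> k \<partial>distr ?\<mu> (borel_on K) u)"
        using borel_measurable_continuous_on_restrict[OF \<gamma>] u\<mu> by (simp add: integral_distr)
      finally show "(\<integral>k. \<gamma> k \<partial>positive_part K (\<nu> x)) = (\<integral>k. \<gamma> k \<partial>distr ?\<mu> (borel_on K) u)" .
    qed (simp_all add: sets_positive_part)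
    then show ?thesis
      using signed_integral_nonneg[OF \<nu> nonneg, of \<beta>] \<beta> u\<mu> by (simp add: integral_distr)
  qed
  then show ?thesis
    using rca1 by (auto simp: quasi_young_measure_of_def rca1_def admissible_test_def)
qed

theorem corollary3p2:
  fixes \<Omega> :: "(real ^ 'd) set"
    and K :: "(real ^ 'l) set"
    and u :: "real ^ 'd \<Rightarrow> real ^ 'l"
    and \<nu> :: "real ^ 'd \<Rightarrow> (real ^ 'l) set \<Rightarrow> real"
    and M :: real
  assumes "open \<Omega>"
    and "emeasure lebesgue \<Omega> = ennreal M"
    and "0 < M"
    and "compact K"
    and "u \<in> lebesgue_on \<Omega> \<rightarrow>\<^sub>M borel_on K"
    and "\<And>x. x \<in> \<Omega> \<Longrightarrow> \<nu> x \<in> rca K"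
  shows "quasi_young_measure_of \<Omega> K u \<nu> \<longleftrightarrow> homogeneous_young_measure_of \<Omega> K u \<nu>"
proof -
  have "\<Omega> \<in> sets lebesgue"
    using assms(1) by (simp add: borel_open)
  then have "emeasure (normalized_lebesgue \<Omega>) \<Omega> = 1"
    using assms(2,3) by (rule emeasure_normalized_lebesgue_space)
  then show ?thesis
    using assms(4,5) quasi_young_measure_of_imp_homogeneous homogeneous_young_measure_of_imp_quasi
    by blast
qed

end
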